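(* Let $K$ be a field and let $P=K[a_1,\dots,a_m,x_1,\dots,x_{n-m}]$ (with $0\le m\le n-1$) be non-negatively $\mathbb{Z}$-graded by $W$ such that $\deg_W(a_i)=0$ for all $i$ and $\deg_W(x_j)>0$ for all $j$. Let $X^\circ=(a_1,\dots,a_m)$, $X^{+}=(x_1,\dots,x_{n-m})$, and $L=K(a_1,\dots,a_m)$. Let $I$ be a $W$-homogeneous ideal in $P$ with $I\cap P_0=\{0\}$, and let $Z=(z_1,\dots,z_s)$ be a tuple of distinct indeterminates of $P$ such that there is a coherently $Z$-separating tuple of $W$-homogeneous polynomials $F=(z_1-h_1,\dots,z_s-h_s)$ in $I$. (a) We have $Z\subseteq X^{+}$ and $h_i\in K[X^\circ,X^{+}\setminus Z]$ for $i=1,\dots,s$. (b) The tuple $F$ is a coherently $Z$-separating tuple in the generic fiber ideal $I_L$. (c) For $\Gamma=(c_1,\dots,c_m)\in K^m$, the tuple $F_\Gamma$ obtained from $F$ by the substitutions $a_i\mapsto c_i$ for $i=1,\dots,m$ is coherently $Z$-separating for the fiber ideal $I_\Gamma$ (i.e., it is a coherently $Z$-separating tuple of polynomials in $I_\Gamma$).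
   Context: $P_0=K[a_1,\dots,a_m]$ is the degree-$0$ component of $P$. The generic fiber ideal is $I_L=I\cdot L[X^{+}]\subseteq L[X^{+}]$. For $\Gamma=(c_1,\dots,c_m)\in K^m$, let $\mathfrak{m}_\Gamma=\langle a_1-c_1,\dots,a_m-c_m\rangle\subseteq P_0$; the (special) fiber ideal over $\Gamma$ is $I_\Gamma=I\cdot(P_0/\mathfrak{m}_\Gamma)[X^{+}]\subseteq K[X^{+}]$, i.e. the image of $I$ under the substitutions $a_i\mapsto c_i$. For a polynomial ring over a field and a tuple $Z=(z_1,\dots,z_s)$ of distinct indeterminates, a tuple $F=(f_1,\dots,f_s)$ of polynomials is coherently $Z$-separating if $f_i=z_i-h_i$ with polynomials $h_i$ such that $z_i$ divides no term in $\mathrm{Supp}(h_j)$ (the set of power products occurring in $h_j$ with nonzero coefficient) for all $i,j\in\{1,\dots,s\}$. *)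

theory Defs
  imports
    "HOL-Library.Poly_Mapping"
    "HOL-Computational_Algebra.Fraction_Field"
    "HOL-Algebra.RingHom"
begin

section \<open>Polynomials over a set of coefficients in a set of indeterminates\<close>

text \<open>
  Power products are finitely supported exponent vectors, and polynomials are finitely
  supported families of coefficients indexed by power products.  Indeterminates are natural
  numbers: in \<open>P = K[a\<^sub>1,\<dots>,a\<^sub>m,x\<^sub>1,\<dots>,x\<^sub>n\<^sub>-\<^sub>m]\<close> the indices \<open>0,\<dots>,m-1\<close> stand for the \<open>a\<^sub>i\<close>
  and \<open>m,\<dots>,n-1\<close> for the \<open>x\<^sub>j\<close>.  Polynomial rings are carved out of the type by a set
  \<open>C\<close> of admissible coefficients and a set \<open>V\<close> of admissible indeterminates (a type of
  indeterminates would rule out the case \<open>m = 0\<close>).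
\<close>

type_synonym pp = "nat \<Rightarrow>\<^sub>0 nat"
type_synonym 'k mpoly = "pp \<Rightarrow>\<^sub>0 'k"

abbreviation supp :: "'k::zero mpoly \<Rightarrow> pp set" where
  "supp \<equiv> Poly_Mapping.keys"

definition const :: "'k::zero \<Rightarrow> 'k mpoly" where
  "const c = Poly_Mapping.single 0 c"

definition indet :: "nat \<Rightarrow> 'k::zero_neq_one mpoly" where
  "indet v = Poly_Mapping.single (Poly_Mapping.single v 1) 1"

definition indet_dvd :: "nat \<Rightarrow> pp \<Rightarrow> bool" where
  "indet_dvd v t \<longleftrightarrow> (\<exists>u. t = Poly_Mapping.single v 1 + u)"

definition polys :: "'k::zero set \<Rightarrow> nat set \<Rightarrow> 'k mpoly set" where
  "polys C V = {p. (\<forall>t. Poly_Mapping.lookup p t \<in> C) \<and> (\<forall>t \<in> supp p. Poly_Mapping.keys t \<subseteq> V)}"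

definition poly_ring :: "'k::comm_ring_1 set \<Rightarrow> nat set \<Rightarrow> 'k mpoly ring" where
  "poly_ring C V = \<lparr>carrier = polys C V, mult = (*), one = 1, zero = 0, add = (+)\<rparr>"

text \<open>The map induced by \<open>\<phi>\<close> on coefficients and by \<open>v \<mapsto> g v\<close> on indeterminates.\<close>

definition poly_eval :: "('k::zero \<Rightarrow> 'b::comm_semiring_1) \<Rightarrow> (nat \<Rightarrow> 'b) \<Rightarrow> 'k mpoly \<Rightarrow> 'b" where
  "poly_eval \<phi> g p =
     (\<Sum>t \<in> supp p. \<phi> (Poly_Mapping.lookup p t) *
        (\<Prod>v \<in> Poly_Mapping.keys t. g v ^ Poly_Mapping.lookup t v))"

section \<open>Gradings\<close>

definition wdeg :: "(nat \<Rightarrow> int) \<Rightarrow> pp \<Rightarrow> int" where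
  "wdeg w t = (\<Sum>v \<in> Poly_Mapping.keys t. int (Poly_Mapping.lookup t v) * w v)"

definition homogeneous :: "(nat \<Rightarrow> int) \<Rightarrow> 'k::zero mpoly \<Rightarrow> bool" where
  "homogeneous w p \<longleftrightarrow> (\<exists>d. \<forall>t \<in> supp p. wdeg w t = d)"

definition hom_component :: "(nat \<Rightarrow> int) \<Rightarrow> int \<Rightarrow> 'k::comm_monoid_add mpoly \<Rightarrow> 'k mpoly" where
  "hom_component w d p =
     (\<Sum>t \<in> {t \<in> supp p. wdeg w t = d}. Poly_Mapping.single t (Poly_Mapping.lookup p t))"

definition homogeneous_ideal ::
    "(nat \<Rightarrow> int) \<Rightarrow> 'k::comm_ring_1 mpoly set \<Rightarrow> 'k mpoly ring \<Rightarrow> bool" where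
  "homogeneous_ideal w I R \<longleftrightarrow> ideal I R \<and> (\<forall>p \<in> I. \<forall>d. hom_component w d p \<in> I)"

section \<open>Generic and special fiber ideals\<close>

text \<open>
  The fraction field \<open>K(a\<^sub>1,\<dots>,a\<^sub>m)\<close>, inside the fraction field of the polynomials in all
  indeterminates.
\<close>

definition rat_funs :: "nat \<Rightarrow> 'k::field mpoly fract set" where
  "rat_funs m = {Fract p q | p q. p \<in> polys UNIV {..<m} \<and> q \<in> polys UNIV {..<m} \<and> q \<noteq> 0}"

text \<open>The inclusion of \<open>P\<close> into \<open>L[X\<^sup>+]\<close>: the \<open>a\<^sub>i\<close> become coefficients.\<close>

definition to_generic :: "nat \<Rightarrow> 'k::field mpoly \<Rightarrow> 'k mpoly fract mpoly" where
  "to_generic m =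
     poly_eval (\<lambda>c. const (Fract (const c) 1))
       (\<lambda>v. if v < m then const (Fract (indet v) 1) else indet v)"

text \<open>The substitution \<open>a\<^sub>i \<mapsto> c\<^sub>i\<close>, where \<open>\<Gamma> = (c\<^sub>1,\<dots>,c\<^sub>m)\<close> is a list.\<close>

definition specialize :: "'k::field list \<Rightarrow> 'k mpoly \<Rightarrow> 'k mpoly" where
  "specialize \<Gamma> = poly_eval const (\<lambda>v. if v < length \<Gamma> then const (\<Gamma> ! v) else indet v)"

definition generic_fiber_ideal ::
    "nat \<Rightarrow> nat \<Rightarrow> 'k::field mpoly set \<Rightarrow> 'k mpoly fract mpoly set" where
  "generic_fiber_ideal m n I = Idl\<^bsub>poly_ring (rat_funs m) {m..<n}\<^esub> (to_generic m ` I)"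

text \<open>
  Extension of \<open>I\<close> to \<open>(P\<^sub>0/\<mm>\<^sub>\<Gamma>)[X\<^sup>+]\<close>, identified with \<open>K[X\<^sup>+]\<close> via \<open>a\<^sub>i \<mapsto> c\<^sub>i\<close>.  As the
  substitution is onto, this is just the image of \<open>I\<close>; see \<open>special_fiber_ideal_eq_image\<close>.
\<close>

definition special_fiber_ideal ::
    "nat \<Rightarrow> 'k::field list \<Rightarrow> 'k mpoly set \<Rightarrow> 'k mpoly set" where
  "special_fiber_ideal n \<Gamma> I = Idl\<^bsub>poly_ring UNIV {length \<Gamma>..<n}\<^esub> (specialize \<Gamma> ` I)"

section \<open>Coherently separating tuples\<close>

definition coherently_separating ::
    "'k::comm_ring_1 set \<Rightarrow> nat set \<Rightarrow> nat list \<Rightarrow> 'k mpoly list \<Rightarrow> bool" where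
  "coherently_separating C V zs fs \<longleftrightarrow>
     distinct zs \<and> set zs \<subseteq> V \<and>
     (\<exists>hs. length hs = length zs \<and> set hs \<subseteq> polys C V \<and>
        fs = map2 (\<lambda>z h. indet z - h) zs hs \<and>
        (\<forall>z \<in> set zs. \<forall>h \<in> set hs. \<forall>t \<in> supp h. \<not> indet_dvd z t))"

section \<open>The carriers are rings, and both substitutions are homomorphisms into them\<close>

text \<open>
  In particular the ideals generated inside \<open>poly_ring (rat_funs m) {m..<n}\<close> and
  \<open>poly_ring UNIV {m..<n}\<close> are the intended ones: \<open>genideal\<close> would give the whole
  type if the carrier were not a ring or did not contain the generators.
\<close>

locale coeff_ring =
  fixes C :: "'k::comm_ring_1 set"
  assumes zero_mem: "0 \<in> C" and one_mem: "1 \<in> C"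
    and add_mem: "a \<in> C \<Longrightarrow> b \<in> C \<Longrightarrow> a + b \<in> C"
    and uminus_mem: "a \<in> C \<Longrightarrow> - a \<in> C"
    and mult_mem: "a \<in> C \<Longrightarrow> b \<in> C \<Longrightarrow> a * b \<in> C"
begin

lemma sum_mem: "(\<And>x. x \<in> A \<Longrightarrow> f x \<in> C) \<Longrightarrow> sum f A \<in> C"
  by (induction A rule: infinite_finite_induct) (auto simp: zero_mem add_mem)

lemma polys_mult:
  assumes "p \<in> polys C V" "q \<in> polys C V"
  shows "p * q \<in> polys C V"
proof -
  have "Poly_Mapping.lookup (p * q) t \<in> C" for t
  proof -
    have "(Poly_Mapping.lookup q s when t = u + s) \<in> C" for u s
      using assms(2) zero_mem by (auto simp: polys_def when_def)
    then have "(\<Sum>s. Poly_Mapping.lookup q s when t = u + s) \<in> C" for u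
      unfolding Sum_any.expand_set by (intro sum_mem)
    then show ?thesis
      using assms(1) unfolding lookup_mult Sum_any.expand_set[of "\<lambda>u. _ u * _ u"]
      by (intro sum_mem mult_mem) (simp_all add: polys_def)
  qed
  moreover have "Poly_Mapping.keys t \<subseteq> V" if *: "t \<in> supp (p * q)" for t
  proof -
    obtain u s where "t = u + s" "u \<in> supp p" "s \<in> supp q"
      using * keys_mult[of p q] by blast
    then show ?thesis
      using assms Poly_Mapping.keys_add[of u s] unfolding polys_def by blast
  qed
  ultimately show ?thesis
    by (auto simp: polys_def)
qed

lemma polys_add:
  assumes "p \<in> polys C V" "q \<in> polys C V"
  shows "p + q \<in> polys C V"
  using assms Poly_Mapping.keys_add[of p q] by (fastforce simp: polys_def lookup_add add_mem)

lemma const_mem_polys: "c \<in> C \<Longrightarrow> const c \<in> polys C V"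
  by (auto simp: polys_def const_def lookup_single when_def zero_mem)

lemma indet_mem_polys: "v \<in> V \<Longrightarrow> indet v \<in> polys C V"
  by (auto simp: polys_def indet_def lookup_single when_def zero_mem one_mem)

lemma polys_one: "1 \<in> polys C V"
  by (auto simp: polys_def lookup_one when_def zero_mem one_mem)

lemma polys_sum: "(\<And>x. x \<in> A \<Longrightarrow> f x \<in> polys C V) \<Longrightarrow> sum f A \<in> polys C V"
proof (induction A rule: infinite_finite_induct)
qed (simp_all add: polys_add, simp_all add: polys_def zero_mem)

lemma polys_prod: "(\<And>x. x \<in> A \<Longrightarrow> f x \<in> polys C V) \<Longrightarrow> prod f A \<in> polys C V"
  by (induction A rule: infinite_finite_induct) (simp_all add: polys_mult polys_one)

lemma polys_power: "p \<in> polys C V \<Longrightarrow> p ^ k \<in> polys C V"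
  by (induction k) (simp_all add: polys_mult polys_one)

lemma poly_eval_mem_polys:
  assumes "\<And>t. t \<in> supp p \<Longrightarrow> \<phi> (Poly_Mapping.lookup p t) \<in> polys C V"
    and "\<And>t v. t \<in> supp p \<Longrightarrow> v \<in> Poly_Mapping.keys t \<Longrightarrow> g v \<in> polys C V"
  shows "poly_eval \<phi> g p \<in> polys C V"
  unfolding poly_eval_def using assms by (intro polys_sum polys_mult polys_prod polys_power)

lemma cring_poly_ring: "cring (poly_ring C V)"
proof (rule cringI)
  have neg: "- p \<in> polys C V" if "p \<in> polys C V" for p
    using that by (auto simp: polys_def uminus_mem)
  show "abelian_group (poly_ring C V)"
  proof (rule abelian_groupI)
    fix p assume "p \<in> carrier (poly_ring C V)"
    then show "\<exists>q \<in> carrier (poly_ring C V). q \<oplus>\<^bsub>poly_ring C V\<^esub> p = \<zero>\<^bsub>poly_ring C V\<^esub>"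
      by (intro bexI[of _ "- p"]) (simp_all add: poly_ring_def neg)
  qed (use zero_mem in \<open>simp_all add: poly_ring_def polys_add, simp_all add: polys_def ac_simps\<close>)
  show "Group.comm_monoid (poly_ring C V)"
    by (rule comm_monoidI)
      (simp_all add: poly_ring_def polys_mult ac_simps, use zero_mem one_mem in \<open>auto simp: polys_def lookup_one when_def\<close>)
qed (auto simp: poly_ring_def algebra_simps)

end

lemma coeff_ring_UNIV: "coeff_ring UNIV"
  by unfold_locales auto

lemma coeff_ring_rat_funs: "coeff_ring (rat_funs m :: 'k::field mpoly fract set)"
proof -
  let ?P = "polys UNIV {..<m} :: 'k mpoly set"
  interpret U: coeff_ring "UNIV :: 'k set"
    by (rule coeff_ring_UNIV)
  have one: "1 \<in> ?P" and zero: "0 \<in> ?P" and neg: "\<And>p. p \<in> ?P \<Longrightarrow> - p \<in> ?P"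
    by (auto simp: polys_def)
  show ?thesis
  proof
    show "0 \<in> (rat_funs m :: 'k mpoly fract set)" "1 \<in> (rat_funs m :: 'k mpoly fract set)"
      unfolding rat_funs_def Zero_fract_def One_fract_def
      using one zero one_neq_zero by blast+
  next
    fix a b :: "'k mpoly fract"
    assume "a \<in> rat_funs m" "b \<in> rat_funs m"
    then obtain p q r s where *: "a = Fract p q" "b = Fract r s" "q \<noteq> 0" "s \<noteq> 0"
      "p \<in> ?P" "q \<in> ?P" "r \<in> ?P" "s \<in> ?P"
      unfolding rat_funs_def by blast
    have "a + b = Fract (p * s + r * q) (q * s)" "a * b = Fract (p * r) (q * s)"
      using * by simp_all
    then show "a + b \<in> rat_funs m" "a * b \<in> rat_funs m"
      using * U.polys_add U.polys_mult unfolding rat_funs_def by (blast dest: no_zero_divisors)+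
  next
    fix a :: "'k mpoly fract"
    assume "a \<in> rat_funs m"
    then show "- a \<in> rat_funs m"
      using neg unfolding rat_funs_def by force
  qed
qed

lemma rat_funs_inverse:
  assumes "a \<in> rat_funs m"
  shows "inverse a \<in> rat_funs m"
proof -
  obtain p q where *: "a = Fract p q" "q \<noteq> 0" "p \<in> polys UNIV {..<m}" "q \<in> polys UNIV {..<m}"
    using assms unfolding rat_funs_def by blast
  show ?thesis
  proof (cases "p = 0")
    case True
    then have "inverse a = a"
      using * by (simp add: fract_collapse)
    with assms show ?thesis by simp
  next
    case False
    have "inverse a = Fract q p"
      unfolding *(1) by (rule inverse_fract)
    with * False show ?thesis
      unfolding rat_funs_def by blast
  qed
qed

lemma poly_eval_superset:
  assumes "finite A" "supp p \<subseteq> A" "\<phi> 0 = 0"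
  shows "poly_eval \<phi> g p = (\<Sum>t \<in> A. \<phi> (Poly_Mapping.lookup p t) *
           (\<Prod>v \<in> Poly_Mapping.keys t. g v ^ Poly_Mapping.lookup t v))"
  unfolding poly_eval_def using assms
  by (intro sum.mono_neutral_left) (auto simp: in_keys_iff)

lemma poly_eval_add:
  assumes "\<phi> 0 = 0" "\<And>a b. \<phi> (a + b) = \<phi> a + \<phi> b"
  shows "poly_eval \<phi> g (p + q) = poly_eval \<phi> g p + poly_eval \<phi> g q"
proof -
  let ?A = "supp p \<union> supp q"
  have "supp (p + q) \<subseteq> ?A"
    by (rule Poly_Mapping.keys_add)
  then show ?thesis
    by (simp add: poly_eval_superset[of ?A] assms lookup_add distrib_right sum.distrib)
qed

lemma poly_eval_sum:
  assumes "\<phi> 0 = 0" "\<And>a b. \<phi> (a + b) = \<phi> a + \<phi> b"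
  shows "poly_eval \<phi> g (sum f A) = (\<Sum>x \<in> A. poly_eval \<phi> g (f x))"
  by (induction A rule: infinite_finite_induct)
    (simp_all add: poly_eval_add[of \<phi>, OF assms], simp_all add: poly_eval_def)

lemma poly_eval_single:
  assumes "\<phi> 0 = 0"
  shows "poly_eval \<phi> g (Poly_Mapping.single t c) =
           \<phi> c * (\<Prod>v \<in> Poly_Mapping.keys t. g v ^ Poly_Mapping.lookup t v)"
  by (simp add: poly_eval_superset[of "{t}"] assms)

lemma prod_power_add:
  fixes s t :: pp and g :: "nat \<Rightarrow> 'b::comm_semiring_1"
  shows "(\<Prod>v \<in> Poly_Mapping.keys (s + t). g v ^ Poly_Mapping.lookup (s + t) v) =
    (\<Prod>v \<in> Poly_Mapping.keys s. g v ^ Poly_Mapping.lookup s v) *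
    (\<Prod>v \<in> Poly_Mapping.keys t. g v ^ Poly_Mapping.lookup t v)"
proof -
  let ?A = "Poly_Mapping.keys s \<union> Poly_Mapping.keys t"
  have *: "(\<Prod>v \<in> Poly_Mapping.keys u. g v ^ Poly_Mapping.lookup u v) =
      (\<Prod>v \<in> ?A. g v ^ Poly_Mapping.lookup u v)" if "Poly_Mapping.keys u \<subseteq> ?A" for u
    using that by (intro prod.mono_neutral_left) (auto simp: in_keys_iff)
  show ?thesis
    by (subst (1 2 3) *) (auto simp: Poly_Mapping.keys_add lookup_add power_add prod.distrib
        dest: subsetD[OF Poly_Mapping.keys_add])
qed

lemma sum_single_eq:
  fixes p :: "'a \<Rightarrow>\<^sub>0 'b::comm_monoid_add"
  shows "(\<Sum>t \<in> Poly_Mapping.keys p. Poly_Mapping.single t (Poly_Mapping.lookup p t)) = p"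
  by (rule poly_mapping_eqI)
    (auto simp: lookup_sum lookup_single when_def in_keys_iff)

lemma poly_eval_mult:
  fixes \<phi> :: "'k::comm_semiring_1 \<Rightarrow> 'b::comm_semiring_1"
  assumes "\<phi> 0 = 0" "\<And>a b. \<phi> (a + b) = \<phi> a + \<phi> b" "\<And>a b. \<phi> (a * b) = \<phi> a * \<phi> b"
  shows "poly_eval \<phi> g (p * q) = poly_eval \<phi> g p * poly_eval \<phi> g q"
proof -
  note [simp] = poly_eval_sum[of \<phi>, OF assms(1,2)] poly_eval_single[of \<phi>, OF assms(1)]
  have "p * q = (\<Sum>s \<in> supp p. \<Sum>t \<in> supp q. Poly_Mapping.single (s + t)
      (Poly_Mapping.lookup p s * Poly_Mapping.lookup q t))"
    by (subst sum_single_eq[of p, symmetric], subst sum_single_eq[of q, symmetric])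
      (simp add: sum_product mult_single)
  then have "poly_eval \<phi> g (p * q) = (\<Sum>s \<in> supp p. \<Sum>t \<in> supp q.
      poly_eval \<phi> g (Poly_Mapping.single s (Poly_Mapping.lookup p s)) *
      poly_eval \<phi> g (Poly_Mapping.single t (Poly_Mapping.lookup q t)))"
    by (simp add: prod_power_add assms(3) mult_ac)
  also have "\<dots> = poly_eval \<phi> g p * poly_eval \<phi> g q"
    by (simp add: sum_product[symmetric], simp add: poly_eval_def)
  finally show ?thesis .
qed

lemma poly_eval_indet:
  fixes \<phi> :: "'k::comm_semiring_1 \<Rightarrow> 'b::comm_semiring_1"
  assumes "\<phi> 0 = 0" "\<phi> 1 = 1"
  shows "poly_eval \<phi> g (indet v) = g v"
  by (simp add: indet_def poly_eval_single[of \<phi>, OF assms(1)] assms(2))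

lemma const_simps [simp]:
  "const 0 = 0" "const 1 = 1" "const (a + b) = const a + const b"
  "const (a * b) = const a * const b"
  by (simp_all add: const_def single_add mult_single)

lemma to_generic_simps:
  fixes p q :: "'k::field mpoly"
  shows "to_generic m (p + q) = to_generic m p + to_generic m q"
    and "to_generic m (p * q) = to_generic m p * to_generic m q"
    and "to_generic m (indet v :: 'k mpoly) = (if v < m then const (Fract (indet v) 1) else indet v)"
proof -
  have "Fract (const (a + b)) 1 = Fract (const a) 1 + Fract (const b) 1"
    "Fract (const (a * b)) 1 = Fract (const a) 1 * Fract (const b) 1" for a b :: 'k
    by simp_all
  then have *: "const (Fract (const (a + b)) 1) = const (Fract (const a) 1) + const (Fract (const b) 1)"
    "const (Fract (const (a * b)) 1) = const (Fract (const a) 1) * const (Fract (const b) 1)"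
    for a b :: 'k
    by (simp_all only: const_simps(3,4))
  have **: "const (Fract (const (0 :: 'k)) 1) = 0" "const (Fract (const (1 :: 'k)) 1) = 1"
    by (simp_all add: fract_collapse)
  show "to_generic m (p + q) = to_generic m p + to_generic m q"
    unfolding to_generic_def by (rule poly_eval_add) (rule * **)+
  show "to_generic m (p * q) = to_generic m p * to_generic m q"
    unfolding to_generic_def by (rule poly_eval_mult) (rule * **)+
  show "to_generic m (indet v :: 'k mpoly) = (if v < m then const (Fract (indet v) 1) else indet v)"
    unfolding to_generic_def by (rule poly_eval_indet) (rule * **)+
qed

lemma to_generic_mem_polys:
  assumes "p \<in> polys UNIV {..<n}"
  shows "to_generic m p \<in> polys (rat_funs m) {m..<n}"
proof -
  interpret U: coeff_ring "UNIV :: 'a set"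
    by (rule coeff_ring_UNIV)
  interpret R: coeff_ring "rat_funs m :: 'a mpoly fract set"
    by (rule coeff_ring_rat_funs)
  have *: "Fract q 1 \<in> rat_funs m" if "q \<in> polys UNIV {..<m}" for q :: "'a mpoly"
    using that U.polys_one one_neq_zero unfolding rat_funs_def by blast
  show ?thesis
    unfolding to_generic_def
  proof (rule R.poly_eval_mem_polys)
    fix t v assume "t \<in> supp p" "v \<in> Poly_Mapping.keys t"
    then have "v < n"
      using assms by (auto simp: polys_def)
    then show "(if v < m then const (Fract (indet v) 1) else indet v)
        \<in> polys (rat_funs m :: 'a mpoly fract set) {m..<n}"
      by (auto intro!: R.const_mem_polys R.indet_mem_polys * U.indet_mem_polys)
  qed (intro R.const_mem_polys * U.const_mem_polys UNIV_I)
qed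

lemma specialize_simps:
  "specialize \<Gamma> (p + q) = specialize \<Gamma> p + specialize \<Gamma> q"
  "specialize \<Gamma> (p * q) = specialize \<Gamma> p * specialize \<Gamma> q"
  "specialize \<Gamma> (indet v) = (if v < length \<Gamma> then const (\<Gamma> ! v) else indet v)"
  unfolding specialize_def by (rule poly_eval_add poly_eval_mult poly_eval_indet; simp)+

lemma indet_power: "(indet v :: 'k::comm_semiring_1 mpoly) ^ k = Poly_Mapping.single (Poly_Mapping.single v k) 1"
proof (induction k)
  case (Suc k)
  show ?case
    unfolding power_Suc Suc.IH by (simp add: indet_def mult_single flip: single_add)
qed simp

lemma prod_indet:
  "(\<Prod>v \<in> Poly_Mapping.keys t. indet v ^ Poly_Mapping.lookup t v) =
    (Poly_Mapping.single t 1 :: 'k::comm_semiring_1 mpoly)"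
proof -
  have "(\<Prod>v \<in> A. Poly_Mapping.single (f v) 1) = (Poly_Mapping.single (sum f A) 1 :: 'k mpoly)"
    for f :: "nat \<Rightarrow> pp" and A
    by (induction A rule: infinite_finite_induct) (simp_all add: mult_single)
  then show ?thesis
    by (simp add: indet_power sum_single_eq)
qed

lemma specialize_eq_self:
  fixes p :: "'k::field mpoly"
  assumes "p \<in> polys UNIV {length \<Gamma>..}"
  shows "specialize \<Gamma> p = p"
proof -
  have "specialize \<Gamma> p = (\<Sum>t \<in> supp p. const (Poly_Mapping.lookup p t) *
      (\<Prod>v \<in> Poly_Mapping.keys t. indet v ^ Poly_Mapping.lookup t v))"
    unfolding specialize_def poly_eval_def
  proof (intro sum.cong prod.cong refl arg_cong2[of _ _ _ _ "(*)"] arg_cong2[of _ _ _ _ "(^)"])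
    fix t v assume "t \<in> supp p" "v \<in> Poly_Mapping.keys t"
    then have "\<not> v < length \<Gamma>"
      using assms unfolding polys_def by fastforce
    then show "(if v < length \<Gamma> then const (\<Gamma> ! v) else indet v) = (indet v :: 'k mpoly)"
      by simp
  qed
  also have "\<dots> = p"
    by (simp add: prod_indet const_def mult_single sum_single_eq)
  finally show ?thesis .
qed

lemma special_fiber_ideal_eq_image:
  fixes I :: "'k::field mpoly set"
  assumes I: "ideal I (poly_ring UNIV {..<n})"
  shows "special_fiber_ideal n \<Gamma> I = specialize \<Gamma> ` I"
proof -
  let ?R = "poly_ring (UNIV :: 'k set) {..<n}" and ?S = "poly_ring (UNIV :: 'k set) {length \<Gamma>..<n}"
  interpret U: coeff_ring "UNIV :: 'k set"
    by (rule coeff_ring_UNIV)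
  interpret R: cring ?R by (rule U.cring_poly_ring)
  interpret S: cring ?S by (rule U.cring_poly_ring)
  interpret I: ideal I ?R by (rule I)
  have maps: "specialize \<Gamma> p \<in> carrier ?S" if p: "p \<in> carrier ?R" for p
    unfolding specialize_def poly_ring_def partial_object.simps
  proof (rule U.poly_eval_mem_polys)
    fix t v assume "t \<in> supp p" "v \<in> Poly_Mapping.keys t"
    then have "v < n"
      using p by (auto simp: poly_ring_def polys_def)
    then show "(if v < length \<Gamma> then const (\<Gamma> ! v) else indet v) \<in> polys (UNIV :: 'k set) {length \<Gamma>..<n}"
      by (auto intro: U.const_mem_polys U.indet_mem_polys)
  qed (rule U.const_mem_polys, simp)
  have self: "specialize \<Gamma> p = p" and sub: "p \<in> carrier ?R" if "p \<in> carrier ?S" for p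
  proof -
    show "specialize \<Gamma> p = p"
      using that by (intro specialize_eq_self) (force simp: poly_ring_def polys_def)
    show "p \<in> carrier ?R"
      using that by (force simp: poly_ring_def polys_def)
  qed
  have hom: "specialize \<Gamma> \<in> ring_hom ?R ?S"
  proof (rule ring_hom_memI)
    show "specialize \<Gamma> \<one>\<^bsub>?R\<^esub> = \<one>\<^bsub>?S\<^esub>"
      using self[OF S.one_closed] by (simp add: poly_ring_def)
  qed (use maps in \<open>simp_all add: poly_ring_def specialize_simps\<close>)
  interpret H: ring_hom_ring ?R ?S "specialize \<Gamma>"
    by (rule ring_hom_ringI2[OF R.ring_axioms S.ring_axioms hom])
  have "ideal (specialize \<Gamma> ` I) ?S"
  proof (rule idealI)
    show "subgroup (specialize \<Gamma> ` I) (add_monoid ?S)"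
      by (rule group_hom.subgroup_img_is_subgroup[OF H.a_group_hom I.a_subgroup])
  next
    fix a x assume "a \<in> specialize \<Gamma> ` I" and x: "x \<in> carrier ?S"
    then obtain b where b: "b \<in> I" "a = specialize \<Gamma> b" by blast
    then have "x \<otimes>\<^bsub>?S\<^esub> a = specialize \<Gamma> (x \<otimes>\<^bsub>?R\<^esub> b)" "a \<otimes>\<^bsub>?S\<^esub> x = specialize \<Gamma> (b \<otimes>\<^bsub>?R\<^esub> x)"
      using self[OF x] by (simp_all add: poly_ring_def specialize_simps)
    then show "x \<otimes>\<^bsub>?S\<^esub> a \<in> specialize \<Gamma> ` I" "a \<otimes>\<^bsub>?S\<^esub> x \<in> specialize \<Gamma> ` I"
      using I.I_l_closed[OF b(1) sub[OF x]] I.I_r_closed[OF b(1) sub[OF x]] by auto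
  qed (rule S.ring_axioms)
  then have "special_fiber_ideal n \<Gamma> I \<subseteq> specialize \<Gamma> ` I"
    unfolding special_fiber_ideal_def by (rule S.genideal_minimal) simp
  moreover have "specialize \<Gamma> ` I \<subseteq> special_fiber_ideal n \<Gamma> I"
    unfolding special_fiber_ideal_def using maps I.Icarr by (intro S.genideal_self) auto
  ultimately show ?thesis by blast
qed

end

theory Submission
  imports Defs
begin

text \<open>
  A homogeneous \<open>z - h\<close> with \<open>z\<close> of degree \<open>0\<close> has only terms of degree \<open>0\<close>, so it lies in
  \<open>I \<inter> P\<^sub>0 = {0}\<close>; but its coefficient at \<open>z\<close> is \<open>1\<close>.  Hence all \<open>z\<^sub>i\<close> are among the \<open>x\<^sub>j\<close>,
  so both substitutions fix them and introduce no new indeterminates into the \<open>h\<^sub>i\<close>.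
\<close>

lemma indet_dvd_iff: "indet_dvd v t \<longleftrightarrow> v \<in> Poly_Mapping.keys t"
proof
  assume "indet_dvd v t"
  then show "v \<in> Poly_Mapping.keys t"
    by (auto simp: indet_dvd_def in_keys_iff lookup_add)
next
  assume "v \<in> Poly_Mapping.keys t"
  \<comment> \<open>Subtraction of exponents is truncated at \<open>0\<close>; nothing is lost here
    because the exponent of \<open>v\<close> in \<open>t\<close> is at least
    \<open>1\<close>.\<close>
  then have "t = Poly_Mapping.single v 1 + (t - Poly_Mapping.single v 1)"
    by (intro poly_mapping_eqI) (auto simp: lookup_add lookup_minus lookup_single when_def in_keys_iff)
  then show "indet_dvd v t"
    unfolding indet_dvd_def by blast
qed

text \<open>Cancelling \<open>g z\<close> entrywise shows that the tuple determines its tails. This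
  identifies the tails hidden behind the existential quantifier in
  \<open>coherently_separating\<close> with a given list \<open>hs\<close>.\<close>

lemma map2_diff_inject:
  fixes hs hs' :: "'b::ab_group_add list"
  assumes "length hs = length zs" "length hs' = length zs"
    and "map2 (\<lambda>z h. g z - h) zs hs = map2 (\<lambda>z h. g z - h) zs hs'"
  shows "hs = hs'"
proof (rule nth_equalityI)
  fix i assume "i < length hs"
  then show "hs ! i = hs' ! i"
    using assms(1,2) arg_cong[OF assms(3), of "\<lambda>xs. xs ! i"] by simp
qed (simp add: assms)

text \<open>Since the tails are unique, the existential quantifier disappears, and non-divisibility
  by all of \<open>zs\<close> becomes membership in a smaller polynomial ring. All three claims are
  checked in this form.\<close>

lemma coherently_separating_map2_iff:
  fixes hs :: "'k::comm_ring_1 mpoly list"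
  assumes "length hs = length zs"
  shows "coherently_separating C V zs (map2 (\<lambda>z h. indet z - h) zs hs) \<longleftrightarrow>
    distinct zs \<and> set zs \<subseteq> V \<and> set hs \<subseteq> polys C (V - set zs)"
proof -
  have "coherently_separating C V zs (map2 (\<lambda>z h. indet z - h) zs hs) \<longleftrightarrow>
      distinct zs \<and> set zs \<subseteq> V \<and> set hs \<subseteq> polys C V \<and>
      (\<forall>z \<in> set zs. \<forall>h \<in> set hs. \<forall>t \<in> supp h. \<not> indet_dvd z t)"
    unfolding coherently_separating_def using assms map2_diff_inject[OF assms] by blast
  also have "\<dots> \<longleftrightarrow> distinct zs \<and> set zs \<subseteq> V \<and> set hs \<subseteq> polys C (V - set zs)"
    unfolding indet_dvd_iff polys_def by blast
  finally show ?thesis .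
qed

lemma map_map2_indet_diff:
  fixes F :: "'a::comm_ring_1 mpoly \<Rightarrow> 'b::comm_ring_1 mpoly"
  assumes add: "\<And>p q. F (p + q) = F p + F q"
    and indet: "\<And>z. z \<in> set zs \<Longrightarrow> F (indet z) = indet z"
  shows "map F (map2 (\<lambda>z h. indet z - h) zs hs) = map2 (\<lambda>z h. indet z - h) zs (map F hs)"
proof -
  \<comment> \<open>Additivity suffices: apply it to \<open>(p - q) + q\<close>.\<close>
  have "F (p - q) = F p - F q" for p q
    using add[of "p - q" q] by (simp add: algebra_simps)
  then show ?thesis
    by (auto simp: zip_map2 indet dest: set_zip_leftD)
qed

lemma lookup_indet_diff:
  assumes "h \<in> polys C V" "z \<notin> V"
  shows "Poly_Mapping.lookup (indet z - h) (Poly_Mapping.single z 1) = 1"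
proof -
  have "Poly_Mapping.single z 1 \<notin> supp h"
    using assms unfolding polys_def by fastforce
  then show ?thesis
    by (simp add: lookup_minus indet_def in_keys_iff)
qed

text \<open>All summands of the degree are nonnegative, so each one vanishes; exponents on the
  support are positive, so the weights there are \<open>0\<close>, which excludes the indices from
  \<open>m\<close> on.\<close>

lemma wdeg_eq_0_keys:
  assumes "\<And>i. i < m \<Longrightarrow> w i = 0" "\<And>j. m \<le> j \<Longrightarrow> j < n \<Longrightarrow> w j > 0"
    and "Poly_Mapping.keys t \<subseteq> {..<n}" "wdeg w t = 0"
  shows "Poly_Mapping.keys t \<subseteq> {..<m}"
proof
  fix v assume v: "v \<in> Poly_Mapping.keys t"
  have "w u \<ge> 0" if "u \<in> Poly_Mapping.keys t" for u
    using assms(1,2)[of u] assms(3) that by (cases "u < m") auto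
  then have "int (Poly_Mapping.lookup t v) * w v = 0"
    using assms(4) v unfolding wdeg_def by (subst (asm) sum_nonneg_eq_0_iff) auto
  then have "w v = 0"
    using v by (simp add: in_keys_iff)
  then show "v \<in> {..<m}"
    using assms(2)[of v] assms(3) v by force
qed

text \<open>A single term of degree \<open>0\<close> forces the common degree of all terms to be
  \<open>0\<close>.\<close>

lemma homogeneous_mem_degree_zero_polys:
  assumes "\<And>i. i < m \<Longrightarrow> w i = 0" "\<And>j. m \<le> j \<Longrightarrow> j < n \<Longrightarrow> w j > 0"
    and p: "homogeneous w p" "p \<in> polys UNIV {..<n}"
    and t: "t \<in> supp p" "wdeg w t = 0"
  shows "p \<in> polys UNIV {..<m}"
proof -
  have "wdeg w u = 0" if "u \<in> supp p" for u
    using p(1) t that unfolding homogeneous_def by metis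
  then show ?thesis
    using wdeg_eq_0_keys[of m w n] assms(1,2) p(2) unfolding polys_def by blast
qed

text \<open>Indeterminates below \<open>m\<close> turn into coefficients and the others stay.
  Allowing any \<open>V\<close> records that the images of the tails still avoid
  \<open>zs\<close>.\<close>

lemma to_generic_mem_polys_Int:
  assumes "p \<in> polys UNIV V"
  shows "to_generic m p \<in> polys (rat_funs m) (V \<inter> {m..})"
proof -
  interpret U: coeff_ring "UNIV :: 'a set"
    by (rule coeff_ring_UNIV)
  interpret R: coeff_ring "rat_funs m :: 'a mpoly fract set"
    by (rule coeff_ring_rat_funs)
  have *: "Fract q 1 \<in> rat_funs m" if "q \<in> polys UNIV {..<m}" for q :: "'a mpoly"
    using that U.polys_one one_neq_zero unfolding rat_funs_def by blast
  show ?thesis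
    unfolding to_generic_def
  proof (rule R.poly_eval_mem_polys)
    fix t v assume "t \<in> supp p" "v \<in> Poly_Mapping.keys t"
    then have "v \<in> V"
      using assms by (auto simp: polys_def)
    then show "(if v < m then const (Fract (indet v) 1) else indet v)
        \<in> polys (rat_funs m :: 'a mpoly fract set) (V \<inter> {m..})"
      by (auto intro!: R.const_mem_polys R.indet_mem_polys * U.indet_mem_polys)
  qed (intro R.const_mem_polys * U.const_mem_polys UNIV_I)
qed

lemma specialize_mem_polys_Int:
  fixes p :: "'k::field mpoly"
  assumes "p \<in> polys UNIV V"
  shows "specialize \<Gamma> p \<in> polys UNIV (V \<inter> {length \<Gamma>..})"
proof -
  interpret U: coeff_ring "UNIV :: 'k set"
    by (rule coeff_ring_UNIV)
  show ?thesis
    unfolding specialize_def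
  proof (rule U.poly_eval_mem_polys)
    fix t v assume "t \<in> supp p" "v \<in> Poly_Mapping.keys t"
    then have "v \<in> V"
      using assms by (auto simp: polys_def)
    then show "(if v < length \<Gamma> then const (\<Gamma> ! v) else indet v)
        \<in> polys (UNIV :: 'k set) (V \<inter> {length \<Gamma>..})"
      by (auto intro!: U.const_mem_polys U.indet_mem_polys)
  qed (rule U.const_mem_polys, simp)
qed

text \<open>The generators lie in the carrier, so the ideal they generate contains them.\<close>

lemma to_generic_image_subset:
  assumes "I \<subseteq> polys UNIV {..<n}"
  shows "to_generic m ` I \<subseteq> generic_fiber_ideal m n I"
proof -
  interpret R: coeff_ring "rat_funs m :: 'a mpoly fract set"
    by (rule coeff_ring_rat_funs)
  interpret S: cring "poly_ring (rat_funs m :: 'a mpoly fract set) {m..<n}"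
    by (rule R.cring_poly_ring)
  have "to_generic m ` I \<subseteq> carrier (poly_ring (rat_funs m) {m..<n})"
    using assms to_generic_mem_polys by (auto simp: poly_ring_def)
  then show ?thesis
    unfolding generic_fiber_ideal_def by (rule S.genideal_self)
qed

theorem proposition5p3:
  fixes m n :: nat
    and w :: "nat \<Rightarrow> int"
    and I :: "'k::field mpoly set"
    and zs :: "nat list"
    and hs fs :: "'k mpoly list"
  assumes "m < n"
    and deg_a: "\<And>i. i < m \<Longrightarrow> w i = 0"
    and deg_x: "\<And>j. m \<le> j \<Longrightarrow> j < n \<Longrightarrow> w j > 0"
    and "homogeneous_ideal w I (poly_ring UNIV {..<n})"
    and "I \<inter> polys UNIV {..<m} = {0}"
    and "length hs = length zs"
    and "fs = map2 (\<lambda>z h. indet z - h) zs hs"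
    and "coherently_separating UNIV {..<n} zs fs"
    and "\<forall>f \<in> set fs. homogeneous w f"
    and "set fs \<subseteq> I"
  shows "(set zs \<subseteq> {m..<n} \<and>
          (\<forall>i < length zs. hs ! i \<in> polys UNIV ({..<m} \<union> ({m..<n} - set zs)))) \<and>
         (coherently_separating (rat_funs m) {m..<n} zs (map (to_generic m) fs) \<and>
          set (map (to_generic m) fs) \<subseteq> generic_fiber_ideal m n I) \<and>
         (\<forall>\<Gamma> :: 'k list. length \<Gamma> = m \<longrightarrow>
            coherently_separating UNIV {m..<n} zs (map (specialize \<Gamma>) fs) \<and>
            set (map (specialize \<Gamma>) fs) \<subseteq> special_fiber_ideal n \<Gamma> I)"
proof -
  have sep: "distinct zs" "set zs \<subseteq> {..<n}" "set hs \<subseteq> polys UNIV ({..<n} - set zs)"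
    using assms by (simp_all add: coherently_separating_map2_iff)
  have ideal: "ideal I (poly_ring UNIV {..<n})"
    using assms by (simp add: homogeneous_ideal_def)
  then have I: "I \<subseteq> polys UNIV {..<n}"
    using additive_subgroup.a_subset[OF ideal.axioms(1)] by (fastforce simp: poly_ring_def)
  have "z \<in> {m..<n}" if z: "z \<in> set zs" for z
  proof (rule ccontr)
    assume "z \<notin> {m..<n}"
    with z sep(2) have "z < m" by force
    obtain i where i: "i < length zs" "z = zs ! i"
      using z by (auto simp: in_set_conv_nth)
    define f where "f = indet z - hs ! i"
    have f: "f \<in> set fs"
      using i assms(6,7) unfolding f_def by (force simp: in_set_conv_nth)
    have "hs ! i \<in> polys UNIV ({..<n} - set zs)"
      using sep(3) i assms(6) by (metis nth_mem subsetD)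
    \<comment> \<open>This coefficient serves twice: it provides the term of degree \<open>0\<close>
      that puts \<open>f\<close> into \<open>P_0\<close>, and it contradicts
      \<open>f = 0\<close>.\<close>
    then have coeff: "Poly_Mapping.lookup f (Poly_Mapping.single z 1) = 1"
      unfolding f_def using z by (intro lookup_indet_diff) auto
    have "f \<in> polys UNIV {..<m}"
    proof (rule homogeneous_mem_degree_zero_polys[OF deg_a deg_x])
      show "homogeneous w f" "f \<in> polys UNIV {..<n}"
        using f assms(9,10) I by auto
      show "Poly_Mapping.single z 1 \<in> supp f"
        using coeff by (simp add: in_keys_iff)
      show "wdeg w (Poly_Mapping.single z 1) = 0"
        using deg_a[OF \<open>z < m\<close>] by (simp add: wdeg_def)
    qed
    then have "f = 0"
      using f assms(5,10) by blast
    with coeff show False by simp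
  qed
  then have zs: "set zs \<subseteq> {m..<n}" by blast
  have V: "({..<n} - set zs) \<inter> {m..} = {m..<n} - set zs"
    by auto

  \<comment> \<open>Removing \<open>zs\<close> leaves the indices below \<open>m\<close> untouched,
    as \<open>zs\<close> lies in \<open>{m..<n}\<close>.\<close>
  have "{..<n} - set zs = {..<m} \<union> ({m..<n} - set zs)"
    using \<open>m < n\<close> zs by fastforce
  then have a: "hs ! i \<in> polys UNIV ({..<m} \<union> ({m..<n} - set zs))" if "i < length zs" for i
    using sep(3) that assms(6) by (metis nth_mem subsetD)

  have "map (to_generic m) fs = map2 (\<lambda>z h. indet z - h) zs (map (to_generic m) hs)"
    unfolding assms(7) using zs by (intro map_map2_indet_diff) (auto simp: to_generic_simps)
  then have b: "coherently_separating (rat_funs m) {m..<n} zs (map (to_generic m) fs)"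
    using sep zs assms(6) to_generic_mem_polys_Int[of _ "{..<n} - set zs" m]
    by (auto simp: coherently_separating_map2_iff V)

  have c: "coherently_separating UNIV {m..<n} zs (map (specialize \<Gamma>) fs)"
    if "length \<Gamma> = m" for \<Gamma> :: "'k list"
  proof -
    have "map (specialize \<Gamma>) fs = map2 (\<lambda>z h. indet z - h) zs (map (specialize \<Gamma>) hs)"
      unfolding assms(7) using zs that
      by (intro map_map2_indet_diff) (auto simp: specialize_simps)
    then show ?thesis
      using sep zs that assms(6) specialize_mem_polys_Int[of _ "{..<n} - set zs" \<Gamma>]
      by (auto simp: coherently_separating_map2_iff V)
  qed

  \<comment> \<open>Only membership in the two fiber ideals remains: each contains the image of
    \<open>I\<close>, and \<open>fs\<close> lies in \<open>I\<close>.\<close>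
  show ?thesis
    using zs a b c to_generic_image_subset[OF I] special_fiber_ideal_eq_image[OF ideal] assms(10)
    by fastforce
qed

end
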